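(* Let $v\ge 1$ be an integer, $\rho>0$, and let $\Sigma$ be a symmetric positive definite real $v\times v$ matrix with eigenvalues $\lambda=(\lambda_1,\dots,\lambda_v)$. Let $R$ be an orthogonal matrix whose columns are orthonormal eigenvectors of $\Sigma$, ordered so that $R^{T}\Sigma R=\mathrm{diag}(\lambda_1,\dots,\lambda_v)$. Let $X\sim\mathcal{N}_v(0,\Sigma)$, and let $\mathfrak{S}$ be the $v\times v$ matrix of second truncated moments $$\mathfrak{S}_{ij}=\mathbb{E}\left[X_iX_j\,\middle|\,X\in\mathcal{B}_v(\rho)\right],\qquad i,j=1,\dots,v .$$ Then $R$ also diagonalizes $\mathfrak{S}$, i.e. $R^{T}\mathfrak{S}R=\mathrm{diag}(\mu_1,\dots,\mu_v)$, with $$\mu_k=\lambda_k\,\frac{\alpha_k(\rho;\lambda)}{\alpha(\rho;\lambda)},\qquad k=1,\dots,v .$$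
   Context: $\mathcal{B}_v(\rho)=\{x\in\mathbb{R}^v:\ x^{T}x\le\rho\}$ is the Euclidean ball of square radius $\rho$ centred at the origin. For $\eta>0$ and $y\in\mathbb{R}$, $\delta(y,\eta)=\frac{1}{\sqrt{2\pi\eta}}\exp\{-\frac{y^2}{2\eta}\}$. For $\lambda\in(0,\infty)^v$, $$\alpha(\rho;\lambda)=\int_{\mathcal{B}_v(\rho)}d^vx\,\prod_{m=1}^v\delta(x_m,\lambda_m),\qquad \alpha_k(\rho;\lambda)=\int_{\mathcal{B}_v(\rho)}d^vx\,\frac{x_k^2}{\lambda_k}\prod_{m=1}^v\delta(x_m,\lambda_m).$$ *)

theory Defs
  imports "HOL-Probability.Probability"
begin

definition diag_matrix :: "real ^ 'n \<Rightarrow> real ^ 'n ^ 'n" where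
  "diag_matrix d = (\<chi> i j. if i = j then d $ i else 0)"

definition symmetric_matrix :: "real ^ 'n ^ 'n \<Rightarrow> bool" where
  "symmetric_matrix A \<longleftrightarrow> transpose A = A"

definition positive_definite_matrix :: "real ^ 'n ^ 'n \<Rightarrow> bool" where
  "positive_definite_matrix A \<longleftrightarrow> (\<forall>x. x \<noteq> 0 \<longrightarrow> x \<bullet> (A *v x) > 0)"

definition eigenpair :: "real ^ 'n ^ 'n \<Rightarrow> real \<Rightarrow> real ^ 'n \<Rightarrow> bool" where
  "eigenpair A c x \<longleftrightarrow> x \<noteq> 0 \<and> A *v x = c *\<^sub>R x"

text \<open>The parameter of \<open>sq_ball\<close> is the square of the radius.\<close>

definition sq_ball :: "real \<Rightarrow> (real ^ 'n) set" where
  "sq_ball \<rho> = {x. x \<bullet> x \<le> \<rho>}"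

text \<open>The second parameter \<open>\<eta>\<close> is the variance, whereas that of \<open>normal_density\<close> is the
  standard deviation.\<close>

definition gauss_delta :: "real \<Rightarrow> real \<Rightarrow> real" where
  "gauss_delta y \<eta> = 1 / sqrt (2 * pi * \<eta>) * exp (- (y\<^sup>2 / (2 * \<eta>)))"

definition ball_alpha :: "real \<Rightarrow> real ^ 'n \<Rightarrow> real" where
  "ball_alpha \<rho> l = (LINT x : sq_ball \<rho> | lborel. (\<Prod>m\<in>UNIV. gauss_delta (x $ m) (l $ m)))"

definition ball_alpha_k :: "'n \<Rightarrow> real \<Rightarrow> real ^ 'n \<Rightarrow> real" where
  "ball_alpha_k k \<rho> l =
     (LINT x : sq_ball \<rho> | lborel.
        (x $ k)\<^sup>2 / l $ k * (\<Prod>m\<in>UNIV. gauss_delta (x $ m) (l $ m)))"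

text \<open>Density of the centred normal law \<open>\<N>(0, \<Sigma>)\<close> for a nondegenerate covariance matrix.\<close>

definition mvn_density :: "real ^ 'n ^ 'n \<Rightarrow> real ^ 'n \<Rightarrow> real" where
  "mvn_density \<Sigma> x =
     exp (- (x \<bullet> (matrix_inv \<Sigma> *v x)) / 2) / sqrt ((2 * pi) ^ CARD('n) * det \<Sigma>)"

text \<open>Expectation conditional on an event: \<open>uniform_measure M A\<close> is
  the conditional probability measure of \<open>M\<close> given \<open>A\<close>.\<close>

definition cond_expectation :: "'a measure \<Rightarrow> 'a set \<Rightarrow> ('a \<Rightarrow> real) \<Rightarrow> real" where
  "cond_expectation M A Y = (LINT \<omega> | uniform_measure M A. Y \<omega>)"

definition truncated_second_moments ::
    "'a measure \<Rightarrow> ('a \<Rightarrow> real ^ 'n) \<Rightarrow> real \<Rightarrow> real ^ 'n ^ 'n" where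
  "truncated_second_moments M X \<rho> =
     (\<chi> i j. cond_expectation M {\<omega> \<in> space M. X \<omega> \<in> sq_ball \<rho>} (\<lambda>\<omega>. X \<omega> $ i * X \<omega> $ j))"

end

theory Submission
  imports Defs
begin

text \<open>The substitution \<open>x = R y\<close> preserves Lebesgue measure and the ball and turns the density of
  \<open>X\<close> into the product \<open>g\<close> of the \<open>gauss_delta (y $ m) (l $ m)\<close>, so the \<open>(k, m)\<close> entry of the
  rotated moment matrix is the integral of \<open>y $ k * y $ m * g y\<close> over the ball, divided by \<open>ball_alpha\<close>.
  For \<open>k \<noteq> m\<close> the reflection of the \<open>k\<close>-th coordinate changes the sign of the integrand only.\<close>

text \<open>By Fubini, a \<open>\<sigma>\<close>-finite translation invariant measure \<open>\<mu>\<close> satisfies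
  \<open>\<mu> A * lborel B = lborel A * \<mu> (- B)\<close>; take for \<open>B\<close> the unit ball, which \<open>T\<close> preserves. The results of
  \<open>Change_Of_Vars\<close> need a well-ordered index type and do not apply to an arbitrary \<open>real ^ 'n\<close>.\<close>

lemma lborel_distr_orthogonal_transformation:
  fixes T :: "'a::euclidean_space \<Rightarrow> 'a"
  assumes T: "orthogonal_transformation T"
  shows "distr lborel borel T = lborel"
proof (rule measure_eqI)
  define \<mu> where "\<mu> = distr lborel borel T"
  have lin: "linear T" and nrm: "\<And>x. norm (T x) = norm x"
    using T by (auto simp: orthogonal_transformation)
  have Tm[measurable]: "T \<in> borel_measurable borel"
    by (intro borel_measurable_continuous_onI linear_continuous_on) (use lin in \<open>simp add: linear_conv_bounded_linear\<close>)
  have sets_mu[measurable_cong, simp]: "sets \<mu> = sets borel" and [simp]: "space \<mu> = UNIV"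
    by (auto simp: \<mu>_def)
  have nn_mu: "(\<integral>\<^sup>+x. f x \<partial>\<mu>) = (\<integral>\<^sup>+x. f (T x) \<partial>lborel)" if [measurable]: "f \<in> borel_measurable borel" for f
    unfolding \<mu>_def by (rule nn_integral_distr) auto
  have shift_l: "(\<integral>\<^sup>+x. f (c + x) \<partial>lborel) = (\<integral>\<^sup>+x. f x \<partial>lborel)"
    if [measurable]: "f \<in> borel_measurable borel" for f :: "'a \<Rightarrow> ennreal" and c
    by (subst (2) lborel_distr_plus[of c, symmetric], subst nn_integral_distr) auto
  have shift_mu: "(\<integral>\<^sup>+x. f (c + x) \<partial>\<mu>) = (\<integral>\<^sup>+x. f x \<partial>\<mu>)"
    if [measurable]: "f \<in> borel_measurable borel" for f :: "'a \<Rightarrow> ennreal" and c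
  proof -
    \<comment> \<open>Surjectivity of \<open>T\<close> writes the shift \<open>c\<close> as
      \<open>T d\<close>; linearity then moves it inside \<open>T\<close>, where it becomes a shift
      under \<open>lborel\<close>.\<close>
    obtain d where d: "c = T d"
      using orthogonal_transformation_surj[OF T] by (metis surjD)
    have "(\<integral>\<^sup>+x. f (c + x) \<partial>\<mu>) = (\<integral>\<^sup>+x. f (T (d + x)) \<partial>lborel)"
      by (subst nn_mu) (auto simp: d linear_add[OF lin])
    also have "\<dots> = (\<integral>\<^sup>+x. f (T x) \<partial>lborel)"
      by (rule shift_l[where f = "\<lambda>x. f (T x)"]) auto
    finally show ?thesis by (simp add: nn_mu)
  qed
  define B where "B = cball (0::'a) 1"
  have [measurable]: "B \<in> sets borel" by (simp add: B_def)
  have indB: "indicator B (T x) = (indicator B x :: ennreal)" "indicator B (- x) = (indicator B x :: ennreal)" for x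
    by (auto simp: B_def nrm indicator_def)
  have muB: "(\<integral>\<^sup>+x. indicator B x \<partial>\<mu>) = emeasure lborel B"
    by (subst nn_mu) (auto simp: indB)
  \<comment> \<open>These two facts permit the final cancellation of
    \<open>emeasure lborel B\<close>.\<close>
  have B0: "emeasure lborel B \<noteq> 0" "emeasure lborel B \<noteq> \<infinity>"
    using unit_ball_vol_pos[of "real DIM('a)", THEN less_imp_neq] by (auto simp: B_def emeasure_cball)
  \<comment> \<open>Fubini requires this. Balls about 0 exhaust the space and equal their preimages
    under \<open>T\<close>, so their \<open>\<mu>\<close>-measure is their volume.\<close>
  interpret mu: sigma_finite_measure \<mu>
  proof
    show "\<exists>A. countable A \<and> A \<subseteq> sets \<mu> \<and> \<Union> A = space \<mu> \<and> (\<forall>a\<in>A. emeasure \<mu> a \<noteq> \<infinity>)"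
    proof (intro exI conjI ballI)
      show "countable (range (\<lambda>n::nat. cball (0::'a) (real n)))" by auto
      show "\<Union> (range (\<lambda>n::nat. cball (0::'a) (real n))) = space \<mu>"
        by (auto intro: real_arch_simple)
      fix a assume "a \<in> range (\<lambda>n::nat. cball (0::'a) (real n))"
      then obtain n where a: "a = cball (0::'a) (real n)" by auto
      have "T -` a = a" by (auto simp: a nrm)
      then show "emeasure \<mu> a \<noteq> \<infinity>"
        by (simp add: \<mu>_def emeasure_distr a emeasure_cball)
    qed auto
  qed
  interpret pair_sigma_finite \<mu> lborel ..
  show "sets (distr lborel borel T) = sets (lborel :: 'a measure)" by simp
  fix A :: "'a set" assume "A \<in> sets (distr lborel borel T)"
  then have A[measurable]: "A \<in> sets borel" by simp
  have "emeasure \<mu> A * emeasure lborel B = (\<integral>\<^sup>+y. (\<integral>\<^sup>+x. indicator A x * indicator B y \<partial>\<mu>) \<partial>lborel)"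
    by (simp add: nn_integral_multc nn_integral_cmult)
  also have "\<dots> = (\<integral>\<^sup>+y. (\<integral>\<^sup>+x. indicator A (y + x) * indicator B y \<partial>\<mu>) \<partial>lborel)"
    by (intro nn_integral_cong shift_mu[symmetric, where f="\<lambda>x. indicator A x * indicator B _"]) measurable
  also have "\<dots> = (\<integral>\<^sup>+x. (\<integral>\<^sup>+y. indicator A (y + x) * indicator B y \<partial>lborel) \<partial>\<mu>)"
    by (rule Fubini') measurable
  \<comment> \<open>For fixed \<open>x\<close>, invariance of \<open>lborel\<close> makes
    \<open>y + x\<close> the new variable, which moves the shift from \<open>A\<close> to
    \<open>B\<close>.\<close>
  also have "\<dots> = (\<integral>\<^sup>+x. (\<integral>\<^sup>+y. indicator A y * indicator B (y - x) \<partial>lborel) \<partial>\<mu>)"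
  proof (rule nn_integral_cong)
    fix x
    show "(\<integral>\<^sup>+y. indicator A (y + x) * indicator B y \<partial>lborel) = (\<integral>\<^sup>+y. indicator A y * indicator B (y - x) \<partial>lborel)"
      by (subst shift_l[symmetric, where c = x]) (auto simp: add.commute)
  qed
  also have "\<dots> = (\<integral>\<^sup>+y. (\<integral>\<^sup>+x. indicator A y * indicator B (y - x) \<partial>\<mu>) \<partial>lborel)"
    by (rule Fubini'[symmetric]) measurable
  also have "\<dots> = (\<integral>\<^sup>+y. indicator A y * emeasure lborel B \<partial>lborel)"
  proof (rule nn_integral_cong)
    fix y
    \<comment> \<open>Since \<open>B = - B\<close>, the points \<open>x\<close> with
      \<open>y - x\<close> in \<open>B\<close> form a translate of \<open>B\<close>, whose
      \<open>\<mu>\<close>-measure is that of \<open>B\<close>.\<close>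
    have "indicator B (y - x) = (indicator B (- y + x) :: ennreal)" for x
      using indB(2)[of "y - x"] by simp
    then have "(\<integral>\<^sup>+x. indicator A y * indicator B (y - x) \<partial>\<mu>) = indicator A y * (\<integral>\<^sup>+x. indicator B (- y + x) \<partial>\<mu>)"
      by (simp add: nn_integral_cmult)
    also have "\<dots> = indicator A y * emeasure lborel B"
      by (subst shift_mu) (auto simp: muB simp del: nn_integral_indicator)
    finally show "(\<integral>\<^sup>+x. indicator A y * indicator B (y - x) \<partial>\<mu>) = indicator A y * emeasure lborel B" .
  qed
  also have "\<dots> = emeasure lborel A * emeasure lborel B"
    by (simp add: nn_integral_multc)
  finally show "emeasure (distr lborel borel T) A = emeasure lborel A"
    using B0 by (simp add: \<mu>_def ennreal_mult_cancel_left mult.commute[of _ "emeasure lborel B"])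
qed

text \<open>Serves twice: for the rotation by \<open>R\<close> and for the reflection of one
  coordinate.\<close>

lemma lborel_integral_orthogonal_transformation:
  fixes T :: "'a::euclidean_space \<Rightarrow> 'a" and f :: "'a \<Rightarrow> real"
  assumes "orthogonal_transformation T" "f \<in> borel_measurable borel"
  shows "(\<integral>x. f (T x) \<partial>lborel) = (\<integral>x. f x \<partial>lborel)"
proof -
  have "T \<in> borel_measurable borel"
    using assms(1) by (intro borel_measurable_continuous_onI linear_continuous_on)
      (simp add: linear_conv_bounded_linear[symmetric] orthogonal_transformation_linear)
  then show ?thesis
    using assms integral_distr[of T lborel borel f]
    by (simp add: lborel_distr_orthogonal_transformation)
qed

text \<open>If \<open>measure M E = 0\<close>, both sides are \<open>0\<close>.\<close>

lemma cond_expectation_eq: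
  assumes "finite_measure M" and E[measurable]: "E \<in> sets M" and Y[measurable]: "Y \<in> borel_measurable M"
  shows "cond_expectation M E Y = (\<integral>\<omega>. indicator E \<omega> * Y \<omega> \<partial>M) / measure M E"
proof -
  interpret finite_measure M by fact
  \<comment> \<open>A real-valued density is wanted for \<open>integral_density\<close>. If
    \<open>E\<close> is null, the \<open>ennreal\<close> quotient is infinite on \<open>E\<close>
    and the real one is 0, so equality holds only almost everywhere.\<close>
  have "AE x in M. indicator E x / emeasure M E = ennreal (indicator E x / measure M E)"
  proof (cases "measure M E = 0")
    case True
    then have "AE x in M. x \<notin> E"
      by (intro AE_not_in) (auto simp: null_sets_def emeasure_eq_measure)
    then show ?thesis by eventually_elim simp
  next
    case False
    then have "0 < measure M E" by (simp add: zero_less_measure_iff)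
    then show ?thesis
      by (intro AE_I2) (auto simp: emeasure_eq_measure indicator_def divide_ennreal[symmetric])
  qed
  then have "uniform_measure M E = density M (\<lambda>x. ennreal (indicator E x / measure M E))"
    unfolding uniform_measure_def by (intro density_cong) auto
  then show ?thesis
    by (simp add: cond_expectation_def integral_density)
qed

lemma sq_ball_eq_cball: "\<rho> \<ge> 0 \<Longrightarrow> sq_ball \<rho> = cball 0 (sqrt \<rho>)"
  by (auto simp: sq_ball_def norm_eq_sqrt_inner)

lemma orthogonal_transformation_matvec:
  fixes R :: "real ^ 'n ^ 'n"
  shows "orthogonal_matrix R \<Longrightarrow> orthogonal_transformation ((*v) R)"
  by (simp add: orthogonal_transformation_matrix)

text \<open>Pairing the eigenvector equation with \<open>x\<close> gives
  \<open>c * (x \<bullet> x) > 0\<close>.\<close>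

lemma eigenpair_positive_definite_pos:
  assumes "positive_definite_matrix A" "eigenpair A c x"
  shows "c > 0"
  using assms unfolding positive_definite_matrix_def eigenpair_def
  by (metis inner_scaleR_right inner_gt_zero_iff zero_less_mult_pos2)

lemma det_diag_matrix: "det (diag_matrix d) = (\<Prod>k\<in>UNIV. d $ k)"
  by (subst det_diagonal) (auto simp: diag_matrix_def)

lemma diag_matrix_mult_vec: "diag_matrix d *v x = (\<chi> k. d $ k * x $ k)"
  by (simp add: vec_eq_iff diag_matrix_def matrix_vector_mult_def if_distrib[of "\<lambda>t. t * _"] cong: if_cong)

text \<open>The real \<open>sqrt\<close> is multiplicative for factors of either sign, and products
  over an infinite set are 1.\<close>

lemma sqrt_prod: "sqrt (\<Prod>i\<in>A. f i) = (\<Prod>i\<in>A. sqrt (f i))"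
  by (induction A rule: infinite_finite_induct) (auto simp: real_sqrt_mult)

text \<open>In eigenvector coordinates the quadratic form is a weighted sum of squares and
  \<open>det \<Sigma>\<close> is the product of the eigenvalues, so the exponential and the
  normalising constant both factor over the coordinates.\<close>

lemma mvn_density_diagonalized:
  fixes \<Sigma> R :: "real ^ 'n ^ 'n"
  assumes R: "orthogonal_matrix R" and D: "transpose R ** \<Sigma> ** R = diag_matrix l"
    and l: "\<And>k. l $ k > 0"
  shows "mvn_density \<Sigma> (R *v y) = (\<Prod>m\<in>UNIV. gauss_delta (y $ m) (l $ m))"
proof -
  have RR: "R ** transpose R = mat 1" "transpose R ** R = mat 1"
    using R by (auto simp: orthogonal_matrix_def)
  have RS: "\<Sigma> ** R = R ** diag_matrix l"
    unfolding D[symmetric] by (simp add: matrix_mul_assoc RR)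
  have det1: "det (transpose R) * det R = 1"
    by (metis det_mul RR(2) det_I)
  have "(det (transpose R) * det R) * det \<Sigma> = (\<Prod>k\<in>UNIV. l $ k)"
    using arg_cong[OF D, of det] by (simp only: det_mul det_diag_matrix mult_ac)
  then have det: "det \<Sigma> = (\<Prod>k\<in>UNIV. l $ k)"
    by (simp only: det1 mult_1)
  then have "invertible \<Sigma>"
    using l by (simp add: invertible_det_nz prod_zero_iff less_imp_neq[symmetric])
  then have inv: "matrix_inv \<Sigma> ** \<Sigma> = mat 1"
    unfolding invertible_def matrix_inv_def by (rule someI2_ex) simp
  \<comment> \<open>Solving \<open>diag_matrix l *v z = y\<close> identifies
    \<open>matrix_inv \<Sigma> *v (R *v y)\<close> as \<open>R *v z\<close> without a formula for
    the inverse matrix.\<close>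
  define z where "z = (\<chi> k. y $ k / l $ k)"
  have "diag_matrix l *v z = y"
    using l by (simp add: diag_matrix_mult_vec z_def vec_eq_iff less_imp_neq[symmetric])
  then have "\<Sigma> *v (R *v z) = R *v y"
    by (metis RS matrix_vector_mul_assoc)
  then have "matrix_inv \<Sigma> *v (R *v y) = R *v z"
    by (metis inv matrix_vector_mul_assoc matrix_vector_mul_lid)
  then have "(R *v y) \<bullet> (matrix_inv \<Sigma> *v (R *v y)) = y \<bullet> z"
    using R by (simp add: orthogonal_transformation_matvec[unfolded orthogonal_transformation_def])
  also have "y \<bullet> z = (\<Sum>k\<in>UNIV. (y $ k)\<^sup>2 / l $ k)"
    by (simp add: inner_vec_def z_def power2_eq_square)
  finally have q: "(R *v y) \<bullet> (matrix_inv \<Sigma> *v (R *v y)) = (\<Sum>k\<in>UNIV. (y $ k)\<^sup>2 / l $ k)" .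
  have "sqrt ((2 * pi) ^ CARD('n) * det \<Sigma>) = (\<Prod>k\<in>UNIV. sqrt (2 * pi * l $ k))"
    by (simp add: det prod.distrib real_sqrt_mult real_sqrt_power sqrt_prod power_mult_distrib)
  then show ?thesis
    by (simp add: mvn_density_def q gauss_delta_def prod_dividef exp_sum[symmetric] sum_negf
        sum_divide_distrib mult.commute)
qed

lemma orthogonal_transformation_reflect_coord:
  "orthogonal_transformation (\<lambda>x::real ^ 'n. \<chi> i. if i = k then - x $ i else x $ i)"
  unfolding orthogonal_transformation_def
  by (auto intro!: linearI sum.cong simp: vec_eq_iff inner_vec_def)

text \<open>Gives measurability of the density and integrability of the moments over the compact
  ball. Writing division as multiplication by a constant inverse leaves no nonvanishing condition to
  check.\<close>

lemma continuous_on_mvn_density: "continuous_on S (mvn_density \<Sigma>)"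
  unfolding mvn_density_def[abs_def] divide_inverse
  by (intro continuous_intros linear_continuous_on) (simp add: linear_conv_bounded_linear[symmetric])

lemma borel_measurable_gauss_delta[measurable]: "(\<lambda>y. gauss_delta y \<eta>) \<in> borel_measurable borel"
  unfolding gauss_delta_def by measurable

theorem mainTheorem1:
  fixes \<Sigma> R :: "real ^ 'n ^ 'n" and l :: "real ^ 'n" and \<rho> :: real
    and M :: "'a measure" and X :: "'a \<Rightarrow> real ^ 'n"
  assumes "\<rho> > 0"
    and "symmetric_matrix \<Sigma>"
    and "positive_definite_matrix \<Sigma>"
    and "orthogonal_matrix R"
    and "\<And>k. eigenpair \<Sigma> (l $ k) (column k R)"
    and "transpose R ** \<Sigma> ** R = diag_matrix l"
    and "prob_space M"
    and "distributed M lborel X (\<lambda>x. ennreal (mvn_density \<Sigma> x))"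
  shows "transpose R ** truncated_second_moments M X \<rho> ** R
           = diag_matrix (\<chi> k. l $ k * (ball_alpha_k k \<rho> l / ball_alpha \<rho> l))"
proof -
  interpret prob_space M by fact
  define A where "A = (sq_ball \<rho> :: (real ^ 'n) set)"
  define f where "f = mvn_density \<Sigma>"
  define g where "g = (\<lambda>y :: real ^ 'n. \<Prod>m\<in>UNIV. gauss_delta (y $ m) (l $ m))"
  define E where "E = {\<omega> \<in> space M. X \<omega> \<in> A}"
  have l: "l $ k > 0" for k
    using eigenpair_positive_definite_pos assms by blast
  have f_R: "f (R *v y) = g y" for y
    unfolding f_def g_def using mvn_density_diagonalized assms l by blast
  have A: "A = cball 0 (sqrt \<rho>)"
    using assms by (simp add: A_def sq_ball_eq_cball)
  have [measurable]: "A \<in> sets borel" and "compact A"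
    by (auto simp: A)
  have X[measurable]: "X \<in> measurable M borel"
    using distributed_measurable[OF assms(8)] by simp
  have [measurable]: "(\<lambda>\<omega>. X \<omega> $ i) \<in> borel_measurable M" for i
    by (rule measurable_compose[OF X]) measurable
  have fc: "continuous_on S f" for S
    unfolding f_def by (rule continuous_on_mvn_density)
  then have [measurable]: "f \<in> borel_measurable borel"
    by (intro borel_measurable_continuous_onI)
  have [measurable]: "g \<in> borel_measurable borel"
    unfolding g_def by measurable
  have E[measurable]: "E \<in> sets M"
    unfolding E_def by measurable
  have R: "orthogonal_transformation ((*v) R)"
    using assms by (simp add: orthogonal_transformation_matvec)
  have RA: "R *v x \<in> A \<longleftrightarrow> x \<in> A" for x
    using R by (simp add: A orthogonal_transformation)
  have f_nonneg: "f x \<ge> 0" for x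
  proof -
    \<comment> \<open>Every point has the form \<open>R *v y\<close>, where the density is a product
      of nonnegative factors.\<close>
    obtain y where "x = R *v y"
      using orthogonal_transformation_surj[OF R] by (metis surjD)
    then show ?thesis by (simp add: f_R g_def gauss_delta_def prod_nonneg l less_imp_le)
  qed
  have transfer: "(\<integral>\<omega>. indicator E \<omega> * h (X \<omega>) \<partial>M) = (\<integral>x. f x * (indicator A x * h x) \<partial>lborel)"
    if [measurable]: "h \<in> borel_measurable borel" for h :: "real ^ 'n \<Rightarrow> real"
  proof -
    have "(\<integral>x. f x * (indicator A x * h x) \<partial>lborel) = (\<integral>\<omega>. indicator A (X \<omega>) * h (X \<omega>) \<partial>M)"
      using assms(8) f_nonneg by (intro distributed_integral) (auto simp: f_def)
    also have "\<dots> = (\<integral>\<omega>. indicator E \<omega> * h (X \<omega>) \<partial>M)"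
      by (intro Bochner_Integration.integral_cong) (auto simp: E_def indicator_def)
    finally show ?thesis ..
  qed
  have rotate: "(\<integral>x. f x * (indicator A x * h x) \<partial>lborel) = (\<integral>y. indicator A y * (h (R *v y) * g y) \<partial>lborel)"
    if [measurable]: "h \<in> borel_measurable borel" for h :: "real ^ 'n \<Rightarrow> real"
    by (subst lborel_integral_orthogonal_transformation[OF R, symmetric])
      (auto simp: f_R RA indicator_def intro!: Bochner_Integration.integral_cong)
  \<comment> \<open>With \<open>h = 1\<close>, the rotated integral is the probability of the
    ball.\<close>
  have alpha: "measure M E = ball_alpha \<rho> l"
    using transfer[of "\<lambda>_. 1"] rotate[of "\<lambda>_. 1"]
    by (simp add: ball_alpha_def set_lebesgue_integral_def A_def g_def)
  have S: "truncated_second_moments M X \<rho> $ i $ j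
      = (\<integral>x. f x * (indicator A x * (x $ i * x $ j)) \<partial>lborel) / ball_alpha \<rho> l" for i j
  proof -
    have "truncated_second_moments M X \<rho> $ i $ j = cond_expectation M E (\<lambda>\<omega>. X \<omega> $ i * X \<omega> $ j)"
      by (simp add: truncated_second_moments_def E_def A_def)
    also have "\<dots> = (\<integral>\<omega>. indicator E \<omega> * (X \<omega> $ i * X \<omega> $ j) \<partial>M) / measure M E"
      by (rule cond_expectation_eq) (unfold_locales, measurable)
    finally show ?thesis
      using transfer[of "\<lambda>x. x $ i * x $ j"] by (simp add: alpha)
  qed
  \<comment> \<open>Needed to exchange the integral with the finite sums of the matrix
    product.\<close>
  have int: "integrable lborel (\<lambda>x. f x * (indicator A x * (x $ i * x $ j)))" for i j
  proof -
    have "continuous_on A (\<lambda>x. f x * (x $ i * x $ j))"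
      by (intro continuous_intros fc)
    from borel_integrable_compact[OF \<open>compact A\<close> this] show ?thesis
      by (simp add: mult_ac)
  qed
  have entry: "(transpose R ** truncated_second_moments M X \<rho> ** R) $ k $ m
      = (\<integral>y. indicator A y * (y $ k * y $ m * g y) \<partial>lborel) / ball_alpha \<rho> l" for k m
  proof -
    have tR: "(\<Sum>i\<in>UNIV. R $ i $ k * (R *v y) $ i) = y $ k" for y k
    proof -
      have "transpose R *v (R *v y) = y"
        using assms(4) by (simp add: orthogonal_matrix_def matrix_vector_mul_assoc)
      then have "(transpose R *v (R *v y)) $ k = y $ k" by simp
      then show ?thesis by (simp add: matrix_vector_mult_def transpose_def)
    qed
    have "(transpose R ** truncated_second_moments M X \<rho> ** R) $ k $ m
      = (\<Sum>j\<in>UNIV. \<Sum>i\<in>UNIV. R $ i $ k * R $ j $ m * (\<integral>x. f x * (indicator A x * (x $ i * x $ j)) \<partial>lborel)) / ball_alpha \<rho> l"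
      by (simp add: matrix_matrix_mult_def transpose_def S sum_divide_distrib sum_distrib_left mult_ac)
    also have "(\<Sum>j\<in>UNIV. \<Sum>i\<in>UNIV. R $ i $ k * R $ j $ m * (\<integral>x. f x * (indicator A x * (x $ i * x $ j)) \<partial>lborel))
      = (\<integral>x. (\<Sum>j\<in>UNIV. \<Sum>i\<in>UNIV. R $ i $ k * R $ j $ m * (f x * (indicator A x * (x $ i * x $ j)))) \<partial>lborel)"
      using int by simp
    \<comment> \<open>The double sum factors into coordinates \<open>k\<close> and \<open>m\<close>
      of \<open>transpose R *v x\<close>; for \<open>x = R *v y\<close> these are
      \<open>y $ k\<close> and \<open>y $ m\<close>.\<close>
    also have "\<dots> = (\<integral>x. f x * (indicator A x * ((\<Sum>i\<in>UNIV. R $ i $ k * x $ i) * (\<Sum>j\<in>UNIV. R $ j $ m * x $ j))) \<partial>lborel)"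
      by (subst sum_product, subst sum.swap) (simp add: sum_distrib_left mult_ac)
    also have "\<dots> = (\<integral>y. indicator A y * (y $ k * y $ m * g y) \<partial>lborel)"
      by (subst rotate) (auto simp: tR)
    finally show ?thesis .
  qed
  have off_diag: "(\<integral>y. indicator A y * (y $ k * y $ m * g y) \<partial>lborel) = 0" if "k \<noteq> m" for k m
  proof -
    define T where "T = (\<lambda>x::real ^ 'n. \<chi> i. if i = k then - x $ i else x $ i)"
    have T: "orthogonal_transformation T"
      unfolding T_def by (rule orthogonal_transformation_reflect_coord)
    \<comment> \<open>\<open>gauss_delta\<close> is even in its first argument.\<close>
    have gT: "g (T y) = g y" for y
      unfolding g_def by (intro prod.cong) (auto simp: T_def gauss_delta_def)
    have AT: "indicator A (T y) = (indicator A y :: real)" for y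
      using T by (simp add: A orthogonal_transformation indicator_def)
    have "(\<integral>y. indicator A y * (y $ k * y $ m * g y) \<partial>lborel)
        = (\<integral>y. indicator A (T y) * (T y $ k * T y $ m * g (T y)) \<partial>lborel)"
      by (rule lborel_integral_orthogonal_transformation[OF T, symmetric]) measurable
    \<comment> \<open>As \<open>k \<noteq> m\<close>, exactly one of the two factors changes sign;
      the integral equals its own negative.\<close>
    also have "\<dots> = - (\<integral>y. indicator A y * (y $ k * y $ m * g y) \<partial>lborel)"
      unfolding gT AT using that by (simp add: T_def)
    finally show ?thesis by simp
  qed
  have diag: "(\<integral>y. indicator A y * (y $ k * y $ k * g y) \<partial>lborel) = l $ k * ball_alpha_k k \<rho> l" for k
    \<comment> \<open>Positivity of \<open>l $ k\<close> allows \<open>(y $ k)^2\<close> to be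
      written as \<open>l $ k * ((y $ k)^2 / l $ k)\<close>.\<close>
    using l[of k] unfolding ball_alpha_k_def set_lebesgue_integral_def
    by (subst integral_mult_right_zero[symmetric])
      (auto intro!: Bochner_Integration.integral_cong simp: A_def g_def power2_eq_square)
  show ?thesis
    by (auto simp: vec_eq_iff entry diag_matrix_def off_diag diag)
qed

end
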